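(* Let $a\in\mathbb{N}$, $a\ge3$, $S=\langle a,a+1,a+2\rangle$ and $r\in\llbracket 0,\mathscr{L}_a)\!)$. Then $r\in S$ if and only if there exist $d,i,c\in\mathbb{Z}$ with $d\ge1$, $i\ge0$ and $c\in\Gamma_i$ such that $r=(a+1)(2d-2+i)+c$. In that case $(d,i,c)=(\delta_r,\iota_r,c_r)$, and in particular $2d-2+i=\ell_r$.
   Context: $\mathbb{N}=\{0,1,2,\dots\}$. $S=\langle a,a+1,a+2\rangle=\{\alpha_1a+\alpha_2(a+1)+\alpha_3(a+2):\alpha_i\in\mathbb{N}\}$. $\operatorname{F}(r,S)=\{\alpha\in\mathbb{N}^3:\alpha_1a+\alpha_2(a+1)+\alpha_3(a+2)=r\}$ and $\delta_r$ denotes its cardinality (the denumerant of $r$). $\mathscr{L}_a=\lfloor a/2\rfloor (a+2)$ if $a$ is even, and $\mathscr{L}_a=(\lfloor a/2\rfloor+2)a$ if $a$ is odd; $\llbracket x,y)\!)=\{n\in\mathbb{Z}:x\le n<y\}$. For $r\in\mathbb{N}$: $\ell_r=\lfloor r/a\rfloor$, $\varepsilon_r=r-a\ell_r$, $\phi_r=(\phi_{r,1},\phi_{r,2},\phi_{r,3})=(\ell_r-\lfloor(\varepsilon_r+1)/2\rfloor,\ \varepsilon_r-2\lfloor\varepsilon_r/2\rfloor,\ \lfloor\varepsilon_r/2\rfloor)$; when $\phi_r\in\mathbb{N}^3$, $\iota_r=\phi_{r,2}+|\phi_{r,1}-\phi_{r,3}|$ and $c_r=\phi_{r,3}-\phi_{r,1}$.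 For $i\in\mathbb{N}$: $\Gamma_0=\{0\}$, $\Gamma_1=\{-1,0,1\}$, and $\Gamma_i=\{-i,-i+1,i-1,i\}$ for $i\ge2$. *)

theory Defs
  imports Main
begin

definition semigroup_S :: "nat \<Rightarrow> nat set" where
  "semigroup_S a = {x * a + y * (a + 1) + z * (a + 2) | x y z :: nat. True}"

definition factorizations :: "nat \<Rightarrow> nat \<Rightarrow> (nat \<times> nat \<times> nat) set" where
  "factorizations a r = {(x, y, z). x * a + y * (a + 1) + z * (a + 2) = r}"

(* The set is finite whenever a > 0, so card is the true cardinality there. *)
definition denumerant :: "nat \<Rightarrow> nat \<Rightarrow> nat" where
  "denumerant a r = card (factorizations a r)"

definition bound_L :: "nat \<Rightarrow> nat" where
  "bound_L a = (if even a then (a div 2) * (a + 2) else (a div 2 + 2) * a)"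

definition ell :: "nat \<Rightarrow> nat \<Rightarrow> int" where
  "ell a r = int r div int a"

definition eps :: "nat \<Rightarrow> nat \<Rightarrow> int" where
  "eps a r = int r - int a * ell a r"

definition phi1 :: "nat \<Rightarrow> nat \<Rightarrow> int" where
  "phi1 a r = ell a r - (eps a r + 1) div 2"

definition phi2 :: "nat \<Rightarrow> nat \<Rightarrow> int" where
  "phi2 a r = eps a r - 2 * (eps a r div 2)"

definition phi3 :: "nat \<Rightarrow> nat \<Rightarrow> int" where
  "phi3 a r = eps a r div 2"

definition phi :: "nat \<Rightarrow> nat \<Rightarrow> int \<times> int \<times> int" where
  "phi a r = (phi1 a r, phi2 a r, phi3 a r)"

(* iota and cc are meaningful only when phi a r has nonnegative entries, i.e.
   phi a r \<in> \<nat> \<times> \<nat> \<times> \<nat>; the formulas are used as total functions, and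
   statements using them must provide that condition separately. *)
definition iota :: "nat \<Rightarrow> nat \<Rightarrow> int" where
  "iota a r = phi2 a r + \<bar>phi1 a r - phi3 a r\<bar>"

definition cc :: "nat \<Rightarrow> nat \<Rightarrow> int" where
  "cc a r = phi3 a r - phi1 a r"

definition Gam :: "nat \<Rightarrow> int set" where
  "Gam i = (if i = 0 then {0}
            else if i = 1 then {-1, 0, 1}
            else {- int i, - int i + 1, int i - 1, int i})"

definition is_rep :: "nat \<Rightarrow> nat \<Rightarrow> int \<Rightarrow> int \<Rightarrow> int \<Rightarrow> bool" where
  "is_rep a r d i c \<longleftrightarrow>
     d \<ge> 1 \<and> i \<ge> 0 \<and> c \<in> Gam (nat i) \<and> int r = (int a + 1) * (2 * d - 2 + i) + c"

end

(* A factorization (x, y, z) of length L = x + y + z lies over r = L a + (y + 2 z), so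
   L a \<le> r \<le> L (a + 2). Below the bound these intervals do not meet, and r determines
   L = r div a and y + 2 z = r mod a. The factorizations are then parametrized by z in an
   interval, which gives the denumerant as min (phi1, phi3) + 1. Conversely, a
   representation with parameters (d, i, c) puts r in the interval of L = 2 d - 2 + i because
   |c| \<le> i \<le> L; then c is the offset of r from L (a + 1), and i is determined by
   |c| \<in> {i - 1, i} together with the parity of L. *)
theory Submission
  imports Defs
begin

text \<open>Both parities give one multiple of \<open>a\<close>, so \<open>r < bound_L a\<close>
  only limits the quotient \<open>r div a\<close> to at most \<open>(a + 1) div 2\<close>.\<close>

lemma bound_L_eq: "bound_L a = ((a + 1) div 2 + 1) * a"
proof (cases "even a")
  case True
  then obtain k where "a = 2 * k" ..
  then show ?thesis by (simp add: bound_L_def algebra_simps)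
next
  case False
  then obtain k where "a = 2 * k + 1" by (rule oddE)
  then show ?thesis by (simp add: bound_L_def)
qed

lemma div_eq_of_between:
  fixes a r L :: nat
  assumes r: "r < bound_L a" and lower: "L * a \<le> r" and upper: "r \<le> L * (a + 2)"
  shows "r div a = L"
proof -
  have "L * a < ((a + 1) div 2 + 1) * a"
    using r lower by (simp add: bound_L_eq)
  then have "L \<le> (a + 1) div 2"
    by (metis Suc_eq_plus1 less_Suc_eq_le mult_less_cancel2)
  \<comment> \<open>While \<open>2 * L < a\<close>, the interval for \<open>L\<close> ends before
    \<open>(L + 1) * a\<close>. At the last value of \<open>L\<close> it may not, but there
    \<open>bound_L a\<close> is exactly \<open>(L + 1) * a\<close>.\<close>
  then consider "2 * L < a" | "L = (a + 1) div 2"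
    by linarith
  then have "r < (L + 1) * a"
  proof cases
    case 1
    then show ?thesis using upper by (simp add: algebra_simps)
  next
    case 2
    then show ?thesis using r by (simp add: bound_L_eq)
  qed
  then show ?thesis
    using lower by (intro div_nat_eqI) (simp_all add: algebra_simps)
qed

lemma factorization_length:
  fixes a r x y z :: nat
  assumes r: "r < bound_L a" and eq: "x * a + y * (a + 1) + z * (a + 2) = r"
  shows "x + y + z = r div a" and "y + 2 * z = r mod a"
proof -
  have r_eq: "r = (x + y + z) * a + (y + 2 * z)"
    using eq by (simp add: algebra_simps)
  show len: "x + y + z = r div a"
    using div_eq_of_between[OF r, of "x + y + z"] r_eq by (simp add: algebra_simps)
  show "y + 2 * z = r mod a"
    using r_eq div_mult_mod_eq[of r a] unfolding len by linarith
qed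

lemma factorization_iff:
  fixes a r x y z :: nat
  assumes "r < bound_L a"
  shows "x * a + y * (a + 1) + z * (a + 2) = r \<longleftrightarrow> x + y + z = r div a \<and> y + 2 * z = r mod a"
    (is "?lhs \<longleftrightarrow> ?rhs")
proof
  assume ?lhs
  then show ?rhs using factorization_length[OF assms] by blast
next
  assume ?rhs
  moreover have "x * a + y * (a + 1) + z * (a + 2) = (x + y + z) * a + (y + 2 * z)"
    by (simp add: algebra_simps)
  ultimately show ?lhs by simp
qed

lemma mem_semigroup_S_iff:
  assumes "r < bound_L a"
  shows "r \<in> semigroup_S a \<longleftrightarrow> r mod a \<le> 2 * (r div a)"
proof -
  have "r \<in> semigroup_S a \<longleftrightarrow> (\<exists>x y z. x * a + y * (a + 1) + z * (a + 2) = r)"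
    unfolding semigroup_S_def by blast
  also have "\<dots> \<longleftrightarrow> (\<exists>x y z. x + y + z = r div a \<and> y + 2 * z = r mod a)"
    unfolding factorization_iff[OF assms] ..
  also have "\<dots> \<longleftrightarrow> r mod a \<le> 2 * (r div a)"
  proof
    assume "r mod a \<le> 2 * (r div a)"
    moreover have "\<exists>x y z. x + y + z = L \<and> y + 2 * z = e" if "e \<le> 2 * L" for e L :: nat
    proof (intro exI)
      \<comment> \<open>The witness is \<open>phi a r\<close>: \<open>z\<close> is as large as
        possible, which leaves \<open>y\<close> in {0, 1}. The hypothesis on \<open>e\<close> keeps
        the subtraction from truncating.\<close>
      show "(L - (e + 1) div 2) + e mod 2 + e div 2 = L \<and> e mod 2 + 2 * (e div 2) = e"
        using that by presburger
    qed
    ultimately show "\<exists>x y z. x + y + z = r div a \<and> y + 2 * z = r mod a"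
      by simp
  qed auto
  finally show ?thesis .
qed

(* Both subtractions of naturals in the result are meant to truncate: they make the
   formula valid also when there is no factorization. *)
lemma denumerant_eq:
  assumes "r < bound_L a"
  shows "denumerant a r = Suc (r mod a div 2) - (r mod a - r div a)"
proof -
  define L e where "L = r div a" and "e = r mod a"
  have "factorizations a r = {(x, y, z). x + y + z = L \<and> y + 2 * z = e}"
    unfolding factorizations_def factorization_iff[OF assms] L_def e_def ..
  \<comment> \<open>Solving for \<open>x\<close> and \<open>y\<close> in terms of \<open>z\<close>:
    \<open>x\<close> is nonnegative iff \<open>e - L \<le> z\<close>, and \<open>y\<close> iff
    \<open>z \<le> e div 2\<close>.\<close>
  also have "\<dots> = (\<lambda>z. (L + z - e, e - 2 * z, z)) ` {e - L..e div 2}"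
    by (auto simp: image_iff)
  finally show ?thesis
    by (simp add: denumerant_def card_image inj_on_def L_def e_def)
qed

lemma ell_eq: "ell a r = int (r div a)"
  by (simp add: ell_def zdiv_int)

lemma eps_eq: "eps a r = int (r mod a)"
  by (simp add: eps_def ell_def zmod_int minus_mult_div_eq_mod)

text \<open>All factorizations arise from \<open>phi a r\<close> by exchanging one \<open>a\<close>
  and one \<open>a + 2\<close> for two copies of \<open>a + 1\<close>, which is possible
  \<open>min (phi1 a r) (phi3 a r)\<close> times.\<close>

lemma denumerant_phi:
  assumes "r < bound_L a" and "r mod a \<le> 2 * (r div a)"
  shows "int (denumerant a r) = min (phi1 a r) (phi3 a r) + 1"
  unfolding denumerant_eq[OF assms(1)] phi1_def phi3_def ell_eq eps_eq
  using assms(2) by linarith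

lemma int_mem_Nats_iff: "n \<in> \<nat> \<longleftrightarrow> 0 \<le> n" for n :: int
  by (metis Nats_cases of_nat_0_le_iff of_nat_in_Nats zero_le_imp_eq_int)

lemma phi_in_Nats:
  assumes "r mod a \<le> 2 * (r div a)"
  shows "phi a r \<in> \<nat> \<times> \<nat> \<times> \<nat>"
proof -
  have "0 \<le> phi1 a r" "0 \<le> phi2 a r" "0 \<le> phi3 a r"
    unfolding phi1_def phi2_def phi3_def ell_eq eps_eq using assms by linarith+
  then show ?thesis
    by (simp_all add: phi_def int_mem_Nats_iff)
qed

lemma ell_phi: "ell a r = phi1 a r + phi2 a r + phi3 a r"
  unfolding phi1_def phi2_def phi3_def by linarith

lemma eps_phi: "eps a r = phi2 a r + 2 * phi3 a r"
  unfolding phi2_def phi3_def by linarith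

lemma phi2_cases: "phi2 a r = 0 \<or> phi2 a r = 1"
  unfolding phi2_def by linarith

text \<open>Rests on the identity 2 min(x, y) + |x - y| = x + y.\<close>

lemma denumerant_iota:
  assumes "r < bound_L a" and "r mod a \<le> 2 * (r div a)"
  shows "2 * int (denumerant a r) - 2 + iota a r = ell a r"
  unfolding denumerant_phi[OF assms] ell_phi iota_def by (simp add: abs_if min_def)

lemma mem_Gam_iff:
  assumes "0 \<le> i"
  shows "c \<in> Gam (nat i) \<longleftrightarrow> \<bar>c\<bar> = i \<or> 1 \<le> i \<and> \<bar>c\<bar> = i - 1"
  using assms by (auto simp: Gam_def nat_eq_iff)

lemma is_rep_canonical:
  assumes "r < bound_L a" and "r mod a \<le> 2 * (r div a)"
  shows "is_rep a r (int (denumerant a r)) (iota a r) (cc a r)"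
proof -
  have nonneg: "0 \<le> phi1 a r" "0 \<le> phi3 a r"
    using phi_in_Nats[OF assms(2)] by (simp_all add: phi_def int_mem_Nats_iff)
  have iota: "0 \<le> iota a r"
    using phi2_cases[of a r] by (auto simp: iota_def)
  note denumerant_iota[OF assms]
  moreover have "int r = (int a + 1) * ell a r + cc a r"
    using ell_phi[of a r] eps_phi[of a r] eps_def[of a r]
    by (simp add: cc_def algebra_simps)
  \<comment> \<open>Here |\<open>cc a r\<close>| is \<open>iota a r - phi2 a r\<close>, and the two
    values 0 and 1 of \<open>phi2 a r\<close> match the two absolute values allowed in
    \<open>Gam\<close>.\<close>
  moreover have "cc a r \<in> Gam (nat (iota a r))"
    unfolding mem_Gam_iff[OF iota] using phi2_cases[of a r] by (auto simp: iota_def cc_def)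
  moreover have "1 \<le> int (denumerant a r)"
    unfolding denumerant_phi[OF assms] using nonneg by linarith
  ultimately show ?thesis
    using iota by (simp add: is_rep_def)
qed

lemma is_rep_unique:
  assumes r: "r < bound_L a" and rep: "is_rep a r d i c"
  shows "r mod a \<le> 2 * (r div a)" and "2 * d - 2 + i = ell a r"
    and "d = int (denumerant a r)" and "i = iota a r" and "c = cc a r"
proof -
  define L where "L = nat (2 * d - 2 + i)"
  have di: "1 \<le> d" "0 \<le> i" and Gam: "\<bar>c\<bar> = i \<or> 1 \<le> i \<and> \<bar>c\<bar> = i - 1"
    using rep mem_Gam_iff by (auto simp: is_rep_def)
  have L: "int L = 2 * d - 2 + i"
    using di by (simp add: L_def)
  have r_eq: "int r = int L * int a + (int L + c)"
    using rep unfolding is_rep_def L[symmetric] by (simp add: algebra_simps)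
  have c: "\<bar>c\<bar> \<le> int L"
    using L di Gam by linarith
  have "int (L * a) \<le> int r" "int r \<le> int (L * (a + 2))"
    using r_eq c by (simp_all add: algebra_simps)
  then have div: "r div a = L"
    using div_eq_of_between[OF r] by (simp only: of_nat_le_iff)
  then show ell: "2 * d - 2 + i = ell a r"
    using L by (simp add: ell_eq)
  have eps: "eps a r = ell a r + c"
    using r_eq unfolding eps_def ell_eq div by (simp add: algebra_simps)
  show le: "r mod a \<le> 2 * (r div a)"
    using eps c div by (simp add: eps_eq ell_eq)
  show cc: "c = cc a r"
    using eps ell_phi[of a r] eps_phi[of a r] by (simp add: cc_def)
  note denumerant_iota[OF r le]
  moreover have "\<bar>c\<bar> = iota a r \<or> \<bar>c\<bar> = iota a r - 1"
    unfolding cc using phi2_cases[of a r] by (auto simp: iota_def cc_def)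
  \<comment> \<open>Both \<open>i\<close> and \<open>iota a r\<close> lie in {|c|, |c| + 1} and have
    the parity of \<open>ell a r\<close>, so they agree; the two length equations then give
    \<open>d\<close>.\<close>
  ultimately show "i = iota a r" "d = int (denumerant a r)"
    using ell Gam by presburger+
qed

theorem theorem3p4:
  fixes a r :: nat
  assumes "a \<ge> 3" and "r \<in> {0..<bound_L a}"
  shows "(r \<in> semigroup_S a \<longleftrightarrow> (\<exists>d i c :: int. is_rep a r d i c))
    \<and> (\<forall>d i c :: int. is_rep a r d i c \<longrightarrow>
          phi a r \<in> \<nat> \<times> \<nat> \<times> \<nat>
          \<and> (d, i, c) = (int (denumerant a r), iota a r, cc a r)
          \<and> 2 * d - 2 + i = ell a r)"
proof -
  have r: "r < bound_L a"
    using assms(2) by simp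
  show ?thesis
  proof (intro conjI allI impI iffI)
    assume "r \<in> semigroup_S a"
    then show "\<exists>d i c. is_rep a r d i c"
      using is_rep_canonical[OF r] mem_semigroup_S_iff[OF r] by auto
  next
    assume "\<exists>d i c. is_rep a r d i c"
    then show "r \<in> semigroup_S a"
      using is_rep_unique(1)[OF r] mem_semigroup_S_iff[OF r] by auto
  next
    fix d i c
    assume rep: "is_rep a r d i c"
    show "phi a r \<in> \<nat> \<times> \<nat> \<times> \<nat>"
      by (rule phi_in_Nats[OF is_rep_unique(1)[OF r rep]])
    show "(d, i, c) = (int (denumerant a r), iota a r, cc a r)"
      using is_rep_unique(3-5)[OF r rep] by simp
    show "2 * d - 2 + i = ell a r"
      by (rule is_rep_unique(2)[OF r rep])
  qed
qed

end
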